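(* For every integer $n \ge 0$, let $d_2(n)$ denote the number of overpartitions of $n$ in which only even parts may be overlined. For an integer $m$ write $\omega_m = m(3m+1)/2$. Then for all $n \ge 0$, $$d_2(n) \equiv \begin{cases} 1 \pmod 4 & \text{if } n = \omega_{4k} \text{ or } n = \omega_{4k+3} \text{ for some integer } k,\\ 3 \pmod 4 & \text{if } n = \omega_{4k+1} \text{ or } n = \omega_{4k+2} \text{ for some integer } k,\\ 0 \pmod 4 & \text{otherwise}.\end{cases}$$
   Context: A partition of $n$ is a non-increasing finite sequence of positive integers (parts) summing to $n$; the empty partition is the unique partition of $0$. An overpartition of $n$ is a partition of $n$ in which the first occurrence of each distinct part value may (optionally) be overlined; equivalently it is a pair $(\mu,\nu)$ where $\mu$ is a partition (the non-overlined parts) and $\nu$ is a partition into distinct parts (the overlined parts) with $|\mu|+|\nu| = n$. The quantity $d_2(n)$ counts those overpartitions of $n$ whose overlined parts are all even, i.e. pairs $(\mu,\nu)$ with $\nu$ a partition into distinct even parts. Its generating function is $\sum_{n\ge0} d_2(n)q^n = \prod_{i\ge1}\frac{1+q^{2i}}{1-q^i}$. The integer $k$ ranges over all integers (positive, zero, or negative), so the $\omega_m$ are the generalized pentagonal numbers. *)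

theory Defs
  imports "HOL-Number_Theory.Cong"
begin

definition is_partition :: "nat \<Rightarrow> nat list \<Rightarrow> bool" where
  "is_partition n xs \<longleftrightarrow> sorted_wrt (\<ge>) xs \<and> (\<forall>x\<in>set xs. x > 0) \<and> sum_list xs = n"

text \<open>An overpartition is a sequence of pairs (part, flag), where the flag says that the part
  is overlined; only the first occurrence of a part value may be overlined.\<close>

definition is_overpartition :: "nat \<Rightarrow> (nat \<times> bool) list \<Rightarrow> bool" where
  "is_overpartition n xs \<longleftrightarrow> is_partition n (map fst xs) \<and>
     (\<forall>i<length xs. snd (xs ! i) \<longrightarrow> (\<forall>j<i. fst (xs ! j) \<noteq> fst (xs ! i)))"

definition d2 :: "nat \<Rightarrow> nat" where
  "d2 n = card {xs. is_overpartition n xs \<and> (\<forall>(x, overlined)\<in>set xs. overlined \<longrightarrow> even x)}"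

text \<open>The division is exact, since one of the factors is even.\<close>

definition omega :: "int \<Rightarrow> int" where
  "omega m = m * (3 * m + 1) div 2"

end

theory Submission
  imports Defs "HOL-Computational_Algebra.Formal_Power_Series"
begin

text \<open>
  With \<open>f\<^sub>k = \<Prod>\<^sub>i (1 - q^(k i))\<close>, the generating function of \<open>d2\<close> is \<open>f\<^sub>4 / (f\<^sub>1 f\<^sub>2)\<close>,
  while \<open>f\<^sub>1(-q) = f\<^sub>2^3 / (f\<^sub>1 f\<^sub>4)\<close>.  Their quotient \<open>f\<^sub>4^2 / f\<^sub>2^4\<close> is 1 modulo 4, because
  \<open>(1 + x)^2\<close> and \<open>(1 - x)^2\<close> agree modulo 4.  So \<open>d2\<close> is congruent to the coefficients of
  \<open>f\<^sub>1(-q)\<close>, which the pentagonal number theorem supplies.  All products are kept finite, with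
  an explicit remainder divisible by a high power of \<open>q\<close>; the pentagonal number theorem then
  follows from a finite identity of Shanks, proved by telescoping.
\<close>

section \<open>The pentagonal number theorem in finite form\<close>

text \<open>Induction on \<open>n\<close>: for \<open>k <= n\<close>, raising \<open>n\<close> by
  one changes the \<open>k\<close>-th summand by a difference of consecutive terms, so the changes
  telescope. The surviving boundary term and the new summand \<open>k = Suc n\<close> are exactly
  the two new powers on the right.\<close>

lemma shanks_identity:
  fixes x :: "'a::comm_ring_1"
  shows "(\<Sum>k\<le>n. (-1) ^ k * (\<Prod>j\<in>{k<..n}. 1 - x ^ j) * x ^ (n * k + k * (k + 1) div 2)) =
    1 + (\<Sum>k=1..n. (-1) ^ k * (x ^ (k * (3 * k - 1) div 2) + x ^ (k * (3 * k + 1) div 2)))"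
proof (induction n)
  case 0
  show ?case by simp
next
  case (Suc n)
  define t where "t k = k * (k + 1) div 2" for k :: nat
  have t_Suc: "t (Suc k) = t k + Suc k" for k
  proof -
    have "Suc k * (Suc k + 1) = k * (k + 1) + 2 * Suc k" by simp
    then show ?thesis unfolding t_def by simp
  qed
  \<comment> \<open>The telescoping sequence, up to the sign \<open>(-1) ^ k\<close>. With
    \<open>p\<close> and \<open>y\<close> as below, \<open>b k = (1 - x ^ k) * p * y\<close>; this
    vanishes at \<open>k = 0\<close>, so the lower end of the telescope contributes nothing.\<close>
  define b where "b k = (if k = 0 then 0 else (\<Prod>j\<in>{k..n}. 1 - x ^ j) * x ^ (n * k + t k))" for k
  have step: "(-1) ^ k * (\<Prod>j\<in>{k<..Suc n}. 1 - x ^ j) * x ^ (Suc n * k + t k) =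
      (-1) ^ k * (\<Prod>j\<in>{k<..n}. 1 - x ^ j) * x ^ (n * k + t k) +
      ((-1) ^ Suc k * b (Suc k) - (-1) ^ k * b k)" if "k \<le> n" for k
  proof -
    define p where "p = (\<Prod>j\<in>{k<..n}. 1 - x ^ j)"
    define y where "y = x ^ (n * k + t k)"
    have "{k<..Suc n} = insert (Suc n) {k<..n}" using that by auto
    then have e1: "(\<Prod>j\<in>{k<..Suc n}. 1 - x ^ j) = (1 - x ^ Suc n) * p"
      by (simp add: p_def)
    have e2: "x ^ (Suc n * k + t k) = x ^ k * y"
      by (simp add: y_def flip: power_add) (simp add: algebra_simps)
    have "{Suc k..n} = {k<..n}" by auto
    then have e3: "b (Suc k) = p * (x ^ k * x ^ Suc n * y)"
      by (simp add: b_def p_def y_def t_Suc flip: power_add power_Suc) (simp add: algebra_simps)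
    have e4: "b k = (1 - x ^ k) * p * y"
    proof (cases "k = 0")
      case False
      have "{k..n} = insert k {k<..n}" using that by auto
      then show ?thesis using False by (simp add: b_def p_def y_def)
    qed (simp add: b_def)
    show ?thesis
      unfolding e1 e2 e3 e4 p_def[symmetric] y_def[symmetric] by (simp add: algebra_simps)
  qed
  have "Suc n * (3 * Suc n - 1) = 2 * (n * Suc n) + Suc n * (Suc n + 1)"
    by (simp add: algebra_simps)
  then have ex1: "Suc n * (3 * Suc n - 1) div 2 = n * Suc n + t (Suc n)"
    unfolding t_def by (simp only: div_mult_self4[OF zero_neq_numeral[symmetric]])
  have "Suc n * (3 * Suc n + 1) = 2 * (Suc n * Suc n) + Suc n * (Suc n + 1)"
    by (simp add: algebra_simps)
  then have ex2: "Suc n * (3 * Suc n + 1) div 2 = Suc n * Suc n + t (Suc n)"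
    unfolding t_def by (simp only: div_mult_self4[OF zero_neq_numeral[symmetric]])
  have "(\<Sum>k\<le>n. (-1) ^ k * (\<Prod>j\<in>{k<..Suc n}. 1 - x ^ j) * x ^ (Suc n * k + t k)) =
      (\<Sum>k\<le>n. (-1) ^ k * (\<Prod>j\<in>{k<..n}. 1 - x ^ j) * x ^ (n * k + t k)) +
      (\<Sum>k<Suc n. (-1) ^ Suc k * b (Suc k) - (-1) ^ k * b k)"
    by (simp only: lessThan_Suc_atMost flip: sum.distrib) (intro sum.cong refl step, simp)
  \<comment> \<open>Only \<open>b (Suc n)\<close> survives, and its product over
    \<open>{Suc n..n}\<close> is empty.\<close>
  also have "(\<Sum>k<Suc n. (-1) ^ Suc k * b (Suc k) - (-1) ^ k * b k) =
      (-1) ^ Suc n * x ^ (Suc n * (3 * Suc n - 1) div 2)"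
    unfolding sum_lessThan_telescope[of "\<lambda>k. (-1) ^ k * b k"] ex1 by (simp add: b_def)
  also note Suc.IH[folded t_def]
  finally have main: "(\<Sum>k\<le>n. (-1) ^ k * (\<Prod>j\<in>{k<..Suc n}. 1 - x ^ j) * x ^ (Suc n * k + t k)) =
      1 + (\<Sum>k=1..n. (-1) ^ k * (x ^ (k * (3 * k - 1) div 2) + x ^ (k * (3 * k + 1) div 2))) +
      (-1) ^ Suc n * x ^ (Suc n * (3 * Suc n - 1) div 2)" .
  have sum_Suc: "(\<Sum>k=1..Suc n. f k) = (\<Sum>k=1..n. f k) + f (Suc n)" for f :: "nat \<Rightarrow> 'a"
    by simp
  have empty: "(\<Prod>j\<in>{Suc n<..Suc n}. 1 - x ^ j) = 1" by simp
  show ?case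
    unfolding sum.atMost_Suc t_def[symmetric] main sum_Suc ex2 empty by (simp only: mult_1_right distrib_left add_ac)
qed

text \<open>The two exponents belonging to \<open>k\<close> are \<open>omega (- k)\<close> and
  \<open>omega k\<close>, so each pair of powers accounts for the indices \<open>m = - k\<close> and
  \<open>m = k\<close>.\<close>

lemma sum_pentagonal_int:
  fixes x :: "'a::comm_ring_1"
  shows "1 + (\<Sum>k=1..n. (-1) ^ k * (x ^ (k * (3 * k - 1) div 2) + x ^ (k * (3 * k + 1) div 2))) =
    (\<Sum>m\<in>{- int n..int n}. (-1) ^ nat \<bar>m\<bar> * x ^ nat (omega m))"
proof (induction n)
  case 0
  show ?case by (simp add: omega_def)
next
  case (Suc n)
  have "int (k * (3 * k + 1) div 2) = omega (int k)" for k
    unfolding omega_def zdiv_int by (rule arg_cong2[of _ _ _ _ "(div)"]) (simp_all add: algebra_simps)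
  then have pos: "nat (omega (int k)) = k * (3 * k + 1) div 2" for k
    by (metis nat_int)
  have "int (Suc n * (3 * Suc n - 1) div 2) = omega (- int (Suc n))"
    unfolding omega_def zdiv_int by (rule arg_cong2[of _ _ _ _ "(div)"]) (simp_all add: algebra_simps)
  then have neg: "nat (omega (- int (Suc n))) = Suc n * (3 * Suc n - 1) div 2"
    by (metis nat_int)
  have "{- int (Suc n)..int (Suc n)} = insert (- int (Suc n)) (insert (int (Suc n)) {- int n..int n})"
    by auto
  then have "(\<Sum>m\<in>{- int (Suc n)..int (Suc n)}. (-1) ^ nat \<bar>m\<bar> * x ^ nat (omega m)) =
      (-1) ^ Suc n * x ^ nat (omega (- int (Suc n))) + ((-1) ^ Suc n * x ^ nat (omega (int (Suc n))) +
      (\<Sum>m\<in>{- int n..int n}. (-1) ^ nat \<bar>m\<bar> * x ^ nat (omega m)))"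
    by (simp add: nat_add_distrib del: of_nat_Suc)
  then show ?case
    unfolding Suc.IH[symmetric] pos neg by (simp add: algebra_simps del: mult_Suc mult_Suc_right)
qed

text \<open>In the sum of Shanks the summand \<open>k = 0\<close> is the whole product, and every
  other summand is divisible by \<open>x ^ Suc n\<close>.\<close>

theorem pentagonal_number_truncated:
  fixes x :: "'a::comm_ring_1"
  obtains b where "(\<Sum>m\<in>{- int n..int n}. (-1) ^ nat \<bar>m\<bar> * x ^ nat (omega m)) =
    (\<Prod>j=1..n. 1 - x ^ j) + x ^ Suc n * b"
proof -
  let ?f = "\<lambda>k. (-1) ^ k * (\<Prod>j\<in>{k<..n}. 1 - x ^ j) * x ^ (n * k + k * (k + 1) div 2)"
  \<comment> \<open>For \<open>k >= 1\<close> the part \<open>n * k\<close> of the exponent is at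
    least \<open>n\<close>, and the triangular number adds at least 1.\<close>
  have "x ^ Suc n dvd ?f k" if "k \<in> {1..n}" for k
  proof -
    have "n * 1 \<le> n * k" using that by (intro mult_le_mono) auto
    moreover have "1 * 2 \<le> k * (k + 1)" using that by (intro mult_le_mono) auto
    ultimately have "Suc n \<le> n * k + k * (k + 1) div 2" by linarith
    then show ?thesis by (intro dvd_mult le_imp_power_dvd)
  qed
  then have "x ^ Suc n dvd (\<Sum>k=1..n. ?f k)" by (rule dvd_sum)
  then obtain b where b: "(\<Sum>k=1..n. ?f k) = x ^ Suc n * b" by (rule dvdE)
  have "{..n} = insert 0 {1..n}" by auto
  then have "(\<Sum>k\<le>n. ?f k) = ?f 0 + (\<Sum>k=1..n. ?f k)" by simp
  also have "{0<..n} = {1..n}" by auto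
  finally have "(\<Sum>k\<le>n. ?f k) = (\<Prod>j=1..n. 1 - x ^ j) + x ^ Suc n * b"
    unfolding b by simp
  with that show ?thesis
    unfolding shanks_identity sum_pentagonal_int by blast
qed

section \<open>Generalized pentagonal numbers and the coefficients of \<open>f_1(-q)\<close>\<close>

lemma omega_double: "2 * omega m = m * (3 * m + 1)"
  unfolding omega_def by simp

text \<open>Ensures that a sum over \<open>m\<close> from \<open>-N\<close> to \<open>N\<close>
  catches every index with \<open>omega m <= N\<close>.\<close>

lemma abs_le_omega: "\<bar>m\<bar> \<le> omega m"
proof (cases "m = 0")
  case False
  then have "\<bar>m\<bar> * 1 \<le> \<bar>m\<bar> * \<bar>m\<bar>" by (intro mult_left_mono) auto
  then have "\<bar>m\<bar> \<le> m * m" by simp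
  moreover have "2 * omega m = 3 * (m * m) + m" unfolding omega_double by (simp add: algebra_simps)
  ultimately show ?thesis by linarith
qed (simp add: omega_def)

lemma omega_nonneg: "0 \<le> omega m"
  using abs_le_omega[of m] by linarith

text \<open>The difference of two values of \<open>2 * omega\<close> has the factor
  \<open>m - k\<close>; the cofactor is 1 modulo 3, hence nonzero.\<close>

lemma inj_omega: "inj omega"
proof
  fix m k assume "omega m = omega k"
  then have "m * (3 * m + 1) = k * (3 * k + 1)"
    using omega_double[of m] omega_double[of k] by simp
  then have "(m - k) * (3 * (m + k) + 1) = 0" by (simp add: algebra_simps)
  moreover have "3 * (m + k) + 1 \<noteq> 0" by presburger
  ultimately show "m = k" by simp
qed

text \<open>Substituting \<open>-q\<close> turns the sign \<open>(-1)^m\<close> into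
  \<open>(-1)^(omega m + m)\<close>, which depends only on \<open>m\<close> modulo 4.\<close>

lemma even_omega_add:
  "even (omega (4 * k) + 4 * k)" "even (omega (4 * k + 3) + (4 * k + 3))"
  "odd (omega (4 * k + 1) + (4 * k + 1))" "odd (omega (4 * k + 2) + (4 * k + 2))"
proof -
  have "omega (4 * k) = 2 * (k * (12 * k + 1))"
    "omega (4 * k + 3) = 2 * (k * (12 * k + 19) + 7) + 1"
    "omega (4 * k + 1) = 2 * (k * (12 * k + 7) + 1)"
    "omega (4 * k + 2) = 2 * (k * (12 * k + 13) + 3) + 1"
    using omega_double[of "4 * k"] omega_double[of "4 * k + 3"] omega_double[of "4 * k + 1"]
      omega_double[of "4 * k + 2"] by (simp_all add: algebra_simps)
  then show "even (omega (4 * k) + 4 * k)" "even (omega (4 * k + 3) + (4 * k + 3))"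
    "odd (omega (4 * k + 1) + (4 * k + 1))" "odd (omega (4 * k + 2) + (4 * k + 2))"
    by simp_all
qed

lemma fps_nth_prod_minus_X:
  assumes "n \<le> N"
  shows "fps_nth (\<Prod>j=1..N. 1 - (- fps_X :: int fps) ^ j) n =
    (\<Sum>m | omega m = int n. if even (omega m + m) then 1 else -1)"
proof -
  obtain b where b: "(\<Sum>m\<in>{- int N..int N}. (-1) ^ nat \<bar>m\<bar> * (- fps_X :: int fps) ^ nat (omega m)) =
      (\<Prod>j=1..N. 1 - (- fps_X) ^ j) + (- fps_X) ^ Suc N * b"
    by (rule pentagonal_number_truncated)
  have pw: "(- fps_X :: int fps) ^ k = fps_const ((-1) ^ k) * fps_X ^ k" for k
    by (subst power_minus) (simp flip: fps_const_power fps_const_neg)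
  have sg: "((-1) ^ k :: int fps) = fps_const ((-1) ^ k)" for k
    by (simp flip: fps_const_power fps_const_neg)
  \<comment> \<open>The remainder starts at degree \<open>Suc N\<close>, beyond
    \<open>n\<close>.\<close>
  have "fps_nth ((- fps_X :: int fps) ^ Suc N * b) n = 0"
    using assms unfolding pw by (simp only: mult.assoc fps_mult_left_const_nth fps_X_power_mult_nth) simp
  then have "fps_nth (\<Prod>j=1..N. 1 - (- fps_X :: int fps) ^ j) n =
      (\<Sum>m\<in>{- int N..int N}. fps_nth ((-1) ^ nat \<bar>m\<bar> * (- fps_X :: int fps) ^ nat (omega m)) n)"
    using arg_cong[OF b, of "\<lambda>f. fps_nth f n"] by (simp add: fps_sum_nth)
  also have "\<dots> = (\<Sum>m\<in>{- int N..int N}.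
      if omega m = int n then if even (omega m + m) then 1 else -1 else 0)"
  proof (intro sum.cong refl)
    fix m
    have "(-1 :: int) ^ nat \<bar>m\<bar> * (-1) ^ nat (omega m) = (if even (omega m + m) then 1 else -1)"
      using omega_nonneg[of m] by (auto simp: minus_one_power_iff even_nat_iff)
    moreover have "nat (omega m) = n \<longleftrightarrow> omega m = int n" using omega_nonneg[of m] by auto
    ultimately show "fps_nth ((-1) ^ nat \<bar>m\<bar> * (- fps_X :: int fps) ^ nat (omega m)) n =
        (if omega m = int n then if even (omega m + m) then 1 else -1 else 0)"
      unfolding pw sg by (auto simp: mult.assoc)
  qed
  also have "\<dots> = (\<Sum>m\<in>{- int N..int N} \<inter> {m. omega m = int n}. if even (omega m + m) then 1 else -1)"
    by (simp only: sum.inter_restrict finite_atLeastAtMost_int mem_Collect_eq)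
  also have "{- int N..int N} \<inter> {m. omega m = int n} = {m. omega m = int n}"
    proof (intro Int_absorb1 subsetI)
    fix m assume "m \<in> {m. omega m = int n}"
    then show "m \<in> {- int N..int N}" using assms abs_le_omega[of m] by simp linarith
  qed
  finally show ?thesis .
qed

section \<open>The generating function of the overpartitions\<close>

lemma is_overpartition_Nil: "is_overpartition n [] \<longleftrightarrow> n = 0"
  by (auto simp: is_overpartition_def is_partition_def)

text \<open>The first part has no predecessor, so either flag is allowed there; prepending it only
  forbids an overlined copy of \<open>x\<close> later on.\<close>

lemma is_overpartition_Cons:
  "is_overpartition n ((x, b) # xs) \<longleftrightarrow>
    0 < x \<and> x \<le> n \<and> is_overpartition (n - x) xs \<and> (\<forall>p\<in>set xs. fst p \<le> x) \<and> (x, True) \<notin> set xs"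
proof -
  let ?Q = "\<lambda>xs :: (nat \<times> bool) list. \<forall>i<length xs. snd (xs ! i) \<longrightarrow> (\<forall>j<i. fst (xs ! j) \<noteq> fst (xs ! i))"
  have "?Q ((x, b) # xs) \<longleftrightarrow> (\<forall>i<length xs. snd (xs ! i) \<longrightarrow> x \<noteq> fst (xs ! i)) \<and> ?Q xs"
    by (auto simp: All_less_Suc2)
  also have "(\<forall>i<length xs. snd (xs ! i) \<longrightarrow> x \<noteq> fst (xs ! i)) \<longleftrightarrow> (x, True) \<notin> set xs"
    by (auto simp: in_set_conv_nth) (metis prod.collapse)
  finally show ?thesis
    unfolding is_overpartition_def is_partition_def by auto
qed

text \<open>The bound \<open>N\<close> on the parts allows induction on the largest part; for
  \<open>N >= n\<close> it imposes no restriction and the count is \<open>d2 n\<close>.\<close>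

definition even_overpartitions :: "nat \<Rightarrow> nat \<Rightarrow> (nat \<times> bool) list set" where
  "even_overpartitions N n = {xs. is_overpartition n xs \<and>
     (\<forall>(x, overlined)\<in>set xs. overlined \<longrightarrow> even x) \<and> (\<forall>p\<in>set xs. fst p \<le> N)}"

lemma finite_even_overpartitions: "finite (even_overpartitions N n)"
proof (rule finite_subset)
  show "even_overpartitions N n \<subseteq> {xs. set xs \<subseteq> {..N} \<times> UNIV \<and> length xs \<le> n}"
  proof (rule subsetI, intro CollectI conjI)
    fix xs assume xs: "xs \<in> even_overpartitions N n"
    then show "set xs \<subseteq> {..N} \<times> UNIV"
      by (force simp: even_overpartitions_def)
    have "length ys \<le> sum_list ys" if "\<forall>y\<in>set ys. y > 0" for ys :: "nat list"
      using that by (induction ys) auto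
    from this[of "map fst xs"] show "length xs \<le> n"
      using xs by (auto simp: even_overpartitions_def is_overpartition_def is_partition_def)
  qed
qed (intro finite_lists_length_le, simp)

lemma even_overpartitions_0: "even_overpartitions 0 n = (if n = 0 then {[]} else {})"
proof -
  have "xs = []" if "xs \<in> even_overpartitions 0 n" for xs
    using that by (cases xs) (auto simp: even_overpartitions_def is_overpartition_Cons)
  moreover have "[] \<in> even_overpartitions 0 n \<longleftrightarrow> n = 0"
    by (simp add: even_overpartitions_def is_overpartition_Nil)
  ultimately show ?thesis by auto
qed

lemma d2_eq_card: "n \<le> N \<Longrightarrow> d2 n = card (even_overpartitions N n)"
proof -
  assume "n \<le> N"
  have "fst p \<le> N" if "is_overpartition n xs" "p \<in> set xs" for xs p
  proof -
    have "fst p \<le> sum_list (map fst xs)" using that(2) by (intro member_le_sum_list) auto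
    then show ?thesis
      using that(1) \<open>n \<le> N\<close> by (simp add: is_overpartition_def is_partition_def)
  qed
  then show ?thesis
    unfolding d2_def even_overpartitions_def by (intro arg_cong[of _ _ card]) auto
qed

text \<open>Deleting the first part of an overpartition whose largest part is \<open>N\<close> leaves one in
  which \<open>N\<close> is not overlined; hence the recursion alternates between two families.\<close>

definition plain_overpartitions :: "nat \<Rightarrow> nat \<Rightarrow> (nat \<times> bool) list set" where
  "plain_overpartitions N n = {xs \<in> even_overpartitions N n. (N, True) \<notin> set xs}"

lemma finite_plain_overpartitions: "finite (plain_overpartitions N n)"
  by (simp add: plain_overpartitions_def finite_even_overpartitions)

lemma plain_overpartitions_Suc:
  "plain_overpartitions (Suc N) n = even_overpartitions N n \<union>
    (if Suc N \<le> n then (#) (Suc N, False) ` plain_overpartitions (Suc N) (n - Suc N) else {})"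
    (is "?L = ?R")
proof (intro set_eqI)
  fix xs :: "(nat \<times> bool) list"
  show "xs \<in> ?L \<longleftrightarrow> xs \<in> ?R"
  proof (cases xs)
    case Nil
    then show ?thesis
      by (auto simp: plain_overpartitions_def even_overpartitions_def is_overpartition_Nil)
  next
    case (Cons p ys)
    obtain x b where p: "p = (x, b)" by (cases p)
    show ?thesis
      unfolding Cons p
      by (cases "x \<le> N"; cases "x = Suc N"; cases b)
        (force simp: plain_overpartitions_def even_overpartitions_def is_overpartition_Cons)+
  qed
qed

text \<open>The leading part \<open>Suc N\<close> may be overlined only if it is even, which is the
  condition \<open>odd N\<close>.\<close>

lemma even_overpartitions_Suc:
  "even_overpartitions (Suc N) n = plain_overpartitions (Suc N) n \<union>
    (if odd N \<and> Suc N \<le> n then (#) (Suc N, True) ` plain_overpartitions (Suc N) (n - Suc N) else {})"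
    (is "?L = ?R")
proof (intro set_eqI)
  fix xs :: "(nat \<times> bool) list"
  show "xs \<in> ?L \<longleftrightarrow> xs \<in> ?R"
  proof (cases xs)
    case Nil
    then show ?thesis
      by (auto simp: plain_overpartitions_def even_overpartitions_def is_overpartition_Nil)
  next
    case (Cons p ys)
    obtain x b where p: "p = (x, b)" by (cases p)
    show ?thesis
      unfolding Cons p
      by (cases "x \<le> N"; cases "x = Suc N"; cases b)
        (force simp: plain_overpartitions_def even_overpartitions_def is_overpartition_Cons)+
  qed
qed

definition even_overpartitions_fps :: "nat \<Rightarrow> int fps" where
  "even_overpartitions_fps N = Abs_fps (\<lambda>n. int (card (even_overpartitions N n)))"

text \<open>The two recursions express both series as multiples of the series \<open>U\<close> of
  the plain family, which cross-multiplication eliminates.\<close>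

lemma even_overpartitions_fps_Suc:
  "even_overpartitions_fps (Suc N) * (1 - fps_X ^ Suc N) =
    even_overpartitions_fps N * (1 + (if odd N then fps_X ^ Suc N else 0))"
proof -
  define U :: "int fps" where "U = Abs_fps (\<lambda>n. int (card (plain_overpartitions (Suc N) n)))"
  have "even_overpartitions_fps N = U * (1 - fps_X ^ Suc N)"
  proof (rule fps_ext)
    fix n
    have "card (plain_overpartitions (Suc N) n) = card (even_overpartitions N n) +
        (if Suc N \<le> n then card (plain_overpartitions (Suc N) (n - Suc N)) else 0)"
      by (subst plain_overpartitions_Suc, subst card_Un_disjoint)
        (auto simp: finite_even_overpartitions finite_plain_overpartitions card_image,
          auto simp: even_overpartitions_def)
    then show "fps_nth (even_overpartitions_fps N) n = fps_nth (U * (1 - fps_X ^ Suc N)) n"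
      by (simp add: even_overpartitions_fps_def U_def right_diff_distrib fps_X_power_mult_right_nth
          del: power_Suc)
  qed
  moreover have "even_overpartitions_fps (Suc N) = U * (1 + (if odd N then fps_X ^ Suc N else 0))"
  proof (rule fps_ext)
    fix n
    have "card (even_overpartitions (Suc N) n) = card (plain_overpartitions (Suc N) n) +
        (if odd N \<and> Suc N \<le> n then card (plain_overpartitions (Suc N) (n - Suc N)) else 0)"
      by (subst even_overpartitions_Suc, subst card_Un_disjoint)
        (auto simp: finite_plain_overpartitions card_image, auto simp: plain_overpartitions_def)
    then show "fps_nth (even_overpartitions_fps (Suc N)) n =
        fps_nth (U * (1 + (if odd N then fps_X ^ Suc N else 0))) n"
      by (simp add: even_overpartitions_fps_def U_def distrib_left fps_X_power_mult_right_nth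
          del: power_Suc)
  qed
  ultimately show ?thesis by (simp add: mult_ac)
qed

text \<open>Each induction step admits one odd and one even part: the odd one adds only a
  denominator factor, the even one also a numerator factor.\<close>

lemma even_overpartitions_fps_product:
  "even_overpartitions_fps (2 * M) * ((\<Prod>i=1..M. 1 - fps_X ^ (2 * i)) * (\<Prod>i=1..M. 1 - fps_X ^ (2 * i - 1))) =
    (\<Prod>i=1..M. 1 + fps_X ^ (2 * i))"
proof (induction M)
  case 0
  show ?case
    by (rule fps_ext) (simp add: even_overpartitions_fps_def even_overpartitions_0)
next
  case (Suc M)
  let ?A = even_overpartitions_fps
  let ?y = "fps_X ^ Suc (2 * M) :: int fps" and ?z = "fps_X ^ Suc (Suc (2 * M)) :: int fps"
  have 1: "?A (Suc (2 * M)) * (1 - ?y) = ?A (2 * M)"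
    using even_overpartitions_fps_Suc[of "2 * M"] by simp
  have 2: "?A (Suc (Suc (2 * M))) * (1 - ?z) = ?A (Suc (2 * M)) * (1 + ?z)"
    using even_overpartitions_fps_Suc[of "Suc (2 * M)"] by simp
  let ?R = "\<Prod>i=1..M. 1 - fps_X ^ (2 * i) :: int fps"
  let ?N = "\<Prod>i=1..M. 1 - fps_X ^ (2 * i - 1) :: int fps"
  have "?A (Suc (Suc (2 * M))) * ((?R * (1 - ?z)) * (?N * (1 - ?y))) =
      (?A (Suc (Suc (2 * M))) * (1 - ?z)) * (1 - ?y) * (?R * ?N)"
    by (simp only: mult_ac)
  also have "\<dots> = (?A (Suc (2 * M)) * (1 - ?y)) * (?R * ?N) * (1 + ?z)"
    unfolding 2 by (simp only: mult_ac)
  also have "\<dots> = (\<Prod>i=1..M. 1 + fps_X ^ (2 * i)) * (1 + ?z)"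
    unfolding 1 Suc.IH ..
  finally show ?case by (simp del: power_Suc)
qed

section \<open>Finite product identities\<close>

lemma prod_even_odd:
  fixes f :: "nat \<Rightarrow> 'a::comm_monoid_mult"
  shows "(\<Prod>i=1..2 * M. f i) = (\<Prod>i=1..M. f (2 * i)) * (\<Prod>i=1..M. f (2 * i - 1))"
  by (induction M) (simp_all add: mult_ac)

lemma prod_one_minus_power_truncated:
  fixes x :: "'a::comm_ring_1"
  assumes "finite A" "\<And>i. i \<in> A \<Longrightarrow> K \<le> g i"
  obtains b where "(\<Prod>i\<in>A. 1 - x ^ g i) = 1 + x ^ K * b"
proof -
  have "\<exists>b. (\<Prod>i\<in>A. 1 - x ^ g i) = 1 + x ^ K * b"
    using assms
  proof (induction A rule: finite_induct)
    case empty
    show ?case by (auto intro: exI[of _ 0])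
  next
    case (insert i A)
    then obtain b where b: "(\<Prod>i\<in>A. 1 - x ^ g i) = 1 + x ^ K * b" by auto
    have "x ^ g i = x ^ K * x ^ (g i - K)"
      using insert.prems[of i] by (simp flip: power_add)
    then have "(\<Prod>i\<in>insert i A. 1 - x ^ g i) = 1 + x ^ K * (b - x ^ (g i - K) * (1 + x ^ K * b))"
      using insert.hyps by (simp add: b algebra_simps)
    then show ?case by blast
  qed
  with that show ?thesis by blast
qed

lemma fps_nth_0_prod_eq_1:
  fixes f :: "'b \<Rightarrow> 'a::comm_ring_1 fps"
  assumes "\<And>i. i \<in> A \<Longrightarrow> fps_nth (f i) 0 = 1"
  shows "fps_nth (\<Prod>i\<in>A. f i) 0 = 1"
  using assms by (induction A rule: infinite_finite_induct) auto

text \<open>Euler's identity between distinct and odd parts, in the variable \<open>q^2\<close>.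
  Multiplying by \<open>?R\<close> completes the left side to the product of
  \<open>1 - q^(2 i)\<close> for \<open>i <= 2 M\<close>; cancelling \<open>?R\<close> leaves only
  the factors with \<open>i > M\<close>.\<close>

lemma euler_odd_distinct_truncated:
  obtains b :: "int fps" where
    "(\<Prod>i=1..M. 1 + fps_X ^ (2 * i - 1)) * (\<Prod>i=1..M. 1 - fps_X ^ (2 * i - 1)) *
      (\<Prod>i=1..M. 1 + fps_X ^ (2 * i)) = 1 + fps_X ^ Suc (2 * M) * b"
proof -
  let ?x = "fps_X ^ 2 :: int fps"
  let ?R = "\<Prod>i=1..M. 1 - ?x ^ i"
  \<comment> \<open>Here \<open>2 * i >= 2 * M + 2\<close>, so each factor is 1 modulo
    \<open>q^(2 M + 1)\<close>.\<close>
  obtain b where b: "(\<Prod>i=M+1..2*M. 1 - (fps_X :: int fps) ^ (2 * i)) = 1 + fps_X ^ Suc (2 * M) * b"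
    by (rule prod_one_minus_power_truncated[of "{M+1..2*M}" "Suc (2 * M)" "\<lambda>i. 2 * i"]) auto
  have "(\<Prod>i=1..M. 1 + fps_X ^ (2 * i - 1)) * (\<Prod>i=1..M. 1 - fps_X ^ (2 * i - 1)) =
      (\<Prod>i=1..M. 1 - ?x ^ (2 * i - 1))"
    unfolding prod.distrib[symmetric]
    by (intro prod.cong refl) (simp add: algebra_simps flip: power_mult power_add mult_2)
  moreover have "?R * (\<Prod>i=1..M. 1 + fps_X ^ (2 * i)) = (\<Prod>i=1..M. 1 - ?x ^ (2 * i))"
    unfolding prod.distrib[symmetric]
    by (intro prod.cong refl) (simp add: algebra_simps flip: power_mult power_add mult_2)
  ultimately have "?R * ((\<Prod>i=1..M. 1 + fps_X ^ (2 * i - 1)) * (\<Prod>i=1..M. 1 - fps_X ^ (2 * i - 1)) *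
      (\<Prod>i=1..M. 1 + fps_X ^ (2 * i))) = (\<Prod>i=1..2 * M. 1 - ?x ^ i)"
    unfolding prod_even_odd by (simp add: mult_ac)
  also have "{1..2 * M} = {1..M} \<union> {M+1..2*M}" by auto
  also have "(\<Prod>i\<in>{1..M} \<union> {M+1..2*M}. 1 - ?x ^ i) = ?R * (\<Prod>i=M+1..2*M. 1 - ?x ^ i)"
    by (intro prod.union_disjoint) auto
  also have "(\<Prod>i=M+1..2*M. 1 - ?x ^ i) = 1 + fps_X ^ Suc (2 * M) * b"
    using b by (simp add: power_mult)
  finally have "?R * ((\<Prod>i=1..M. 1 + fps_X ^ (2 * i - 1)) * (\<Prod>i=1..M. 1 - fps_X ^ (2 * i - 1)) *
      (\<Prod>i=1..M. 1 + fps_X ^ (2 * i))) = ?R * (1 + fps_X ^ Suc (2 * M) * b)" .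
  moreover have "fps_nth ?R 0 = 1"
    by (rule fps_nth_0_prod_eq_1) (simp flip: power_mult)
  then have "?R \<noteq> 0" by (metis fps_zero_nth zero_neq_one)
  ultimately have "(\<Prod>i=1..M. 1 + fps_X ^ (2 * i - 1)) * (\<Prod>i=1..M. 1 - fps_X ^ (2 * i - 1)) *
      (\<Prod>i=1..M. 1 + fps_X ^ (2 * i)) = 1 + fps_X ^ Suc (2 * M) * b"
    by (metis mult_left_cancel)
  with that show ?thesis by blast
qed

text \<open>Factor by factor, \<open>(1 + f)^2 = (1 - f)^2 + 4 f\<close>.\<close>

lemma prod_one_plus_square_mod_4:
  fixes f :: "'b \<Rightarrow> 'a::comm_ring_1"
  obtains c where "(\<Prod>i\<in>A. 1 + f i)\<^sup>2 = (\<Prod>i\<in>A. 1 - f i)\<^sup>2 + 4 * c"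
proof -
  have "\<exists>c. (\<Prod>i\<in>A. 1 + f i)\<^sup>2 = (\<Prod>i\<in>A. 1 - f i)\<^sup>2 + 4 * c"
  proof (induction A rule: infinite_finite_induct)
    case (insert i A)
    then obtain c where "(\<Prod>i\<in>A. 1 + f i)\<^sup>2 = (\<Prod>i\<in>A. 1 - f i)\<^sup>2 + 4 * c" by blast
    then have "(\<Prod>i\<in>insert i A. 1 + f i)\<^sup>2 =
        (\<Prod>i\<in>insert i A. 1 - f i)\<^sup>2 + 4 * (f i * (\<Prod>i\<in>A. 1 - f i)\<^sup>2 + (1 + f i)\<^sup>2 * c)"
      using insert.hyps by (simp add: power_mult_distrib) (simp add: power2_eq_square algebra_simps)
    then show ?case by blast
  qed (auto intro: exI[of _ 0])
  with that show ?thesis by blast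
qed

section \<open>The congruence modulo 4\<close>

text \<open>Multiplying \<open>A * R * N = S\<close> by \<open>P * S\<close> and using that
  \<open>P * N * S\<close> is 1 up to high powers of \<open>q\<close> gives \<open>R * A\<close> in
  terms of \<open>P * S^2\<close>. Modulo 4 this is \<open>P * R^2\<close>, and cancelling
  \<open>R\<close> leaves \<open>R * P\<close>.\<close>

lemma d2_cong_product:
  assumes "n \<le> 2 * M"
  shows "[int (d2 n) = fps_nth (\<Prod>j=1..2 * M. 1 - (- fps_X :: int fps) ^ j) n] (mod 4)"
proof -
  define A where "A = even_overpartitions_fps (2 * M)"
  define R S P N :: "int fps" where "R = (\<Prod>i=1..M. 1 - fps_X ^ (2 * i))"
    and "S = (\<Prod>i=1..M. 1 + fps_X ^ (2 * i))"
    and "P = (\<Prod>i=1..M. 1 + fps_X ^ (2 * i - 1))"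
    and "N = (\<Prod>i=1..M. 1 - fps_X ^ (2 * i - 1))"
  \<comment> \<open>Even \<open>j\<close> give the factors of \<open>R\<close>; odd \<open>j\<close>
    change the sign and give those of \<open>P\<close>.\<close>
  have Q: "(\<Prod>j=1..2 * M. 1 - (- fps_X :: int fps) ^ j) = R * P"
    unfolding prod_even_odd R_def P_def
    by (intro arg_cong2[of _ _ _ _ "(*)"] prod.cong refl) auto
  have ARN: "A * (R * N) = S"
    unfolding A_def R_def S_def N_def by (rule even_overpartitions_fps_product)
  obtain b where b: "P * N * S = 1 + fps_X ^ Suc (2 * M) * b"
    unfolding P_def N_def S_def by (rule euler_odd_distinct_truncated)
  obtain c where c: "S\<^sup>2 = R\<^sup>2 + 4 * c"
    unfolding R_def S_def by (rule prod_one_plus_square_mod_4)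
  \<comment> \<open>Constant term 1 makes \<open>R\<close> a unit over the integers; multiplying by
    its inverse \<open>T\<close> preserves the congruence modulo 4.\<close>
  have "fps_nth R 0 = 1"
    unfolding R_def by (rule fps_nth_0_prod_eq_1) auto
  then obtain T where T: "R * T = 1"
    using fps_right_inverse[of R 1] by auto
  have "R * (A * (1 + fps_X ^ Suc (2 * M) * b)) = P * S * (A * (R * N))"
    unfolding b[symmetric] by (simp add: mult_ac)
  also have "\<dots> = P * S\<^sup>2"
    unfolding ARN by (simp add: power2_eq_square mult_ac)
  also have "\<dots> = R * (R * P) + 4 * (c * P)"
    unfolding c by (simp add: power2_eq_square algebra_simps)
  finally have "T * (R * (A * (1 + fps_X ^ Suc (2 * M) * b))) = T * (R * (R * P) + 4 * (c * P))"
    by simp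
  then have "(T * R) * (A * (1 + fps_X ^ Suc (2 * M) * b)) = (T * R) * (R * P) + 4 * (T * c * P)"
    by (simp add: algebra_simps)
  moreover have "T * R = 1" using T by (simp add: mult.commute)
  ultimately have "A * (1 + fps_X ^ Suc (2 * M) * b) = R * P + 4 * (T * c * P)" by simp
  then have "A + fps_X ^ Suc (2 * M) * (A * b) = R * P + 4 * (T * c * P)"
    by (simp only: distrib_left mult_1_right mult_ac)
  then have "fps_nth A n + fps_nth (fps_X ^ Suc (2 * M) * (A * b)) n =
      fps_nth (R * P) n + fps_nth (4 * (T * c * P)) n"
    by (metis fps_add_nth)
  moreover have "fps_nth (fps_X ^ Suc (2 * M) * (A * b)) n = 0"
    using assms by (simp only: fps_X_power_mult_nth) simp
  moreover have "fps_nth (4 * (T * c * P)) n = 4 * fps_nth (T * c * P) n"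
    by (simp add: fps_numeral_fps_const)
  moreover have "fps_nth A n = int (d2 n)"
    using assms by (simp add: A_def even_overpartitions_fps_def d2_eq_card)
  ultimately show ?thesis
    unfolding Q cong_iff_dvd_diff by simp
qed

theorem theorem2:
  fixes n :: nat
  shows "((\<exists>k. int n = omega (4 * k) \<or> int n = omega (4 * k + 3)) \<longrightarrow> [d2 n = 1] (mod 4)) \<and>
         ((\<exists>k. int n = omega (4 * k + 1) \<or> int n = omega (4 * k + 2)) \<longrightarrow> [d2 n = 3] (mod 4)) \<and>
         (\<not> (\<exists>k. int n = omega (4 * k) \<or> int n = omega (4 * k + 3)) \<and>
          \<not> (\<exists>k. int n = omega (4 * k + 1) \<or> int n = omega (4 * k + 2)) \<longrightarrow> [d2 n = 0] (mod 4))"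
proof -
  let ?s = "\<lambda>m. if even (omega m + m) then 1 else - 1 :: int"
  have d2: "[int (d2 n) = (\<Sum>m | omega m = int n. ?s m)] (mod 4)"
    using d2_cong_product[of n n] fps_nth_prod_minus_X[of n "2 * n"] by simp
  have single: "[int (d2 n) = ?s m] (mod 4)" if "int n = omega m" for m
  proof -
    \<comment> \<open>Injectivity of \<open>omega\<close> reduces the sum to a single sign.\<close>
    have "{k. omega k = int n} = {m}" using that inj_omega by (auto dest: injD)
    then show ?thesis using d2 by simp
  qed
  have one: "[d2 n = 1] (mod 4)" if "int n = omega m" "even (omega m + m)" for m
    using single[OF that(1)] that(2) by (simp flip: cong_int_iff)
  have three: "[d2 n = 3] (mod 4)" if "int n = omega m" "odd (omega m + m)" for m
  proof -
    have "[int (d2 n) = -1] (mod 4)" using single[OF that(1)] that(2) by simp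
    also have "[-1 = (3 :: int)] (mod 4)" by (simp add: cong_def)
    finally show ?thesis by (simp flip: cong_int_iff)
  qed
  have zero: "[d2 n = 0] (mod 4)" if "\<nexists>m. int n = omega m"
  proof -
    have "{m. omega m = int n} = {}" using that by (metis (mono_tags) Collect_empty_eq)
    then show ?thesis using d2 by (simp flip: cong_int_iff)
  qed
  \<comment> \<open>The four residue classes exhaust the integers, so in the last case
    \<open>n\<close> is no value of \<open>omega\<close> and the sum is empty.\<close>
  have residue: "\<exists>k. m = 4 * k \<or> m = 4 * k + 1 \<or> m = 4 * k + 2 \<or> m = 4 * k + 3" for m :: int
    by presburger
  show ?thesis
    using one three zero residue even_omega_add by metis
qed

end
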